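(* Let $N$ be a nonnegative integer. Then there exists a real valued trigonometric polynomial $$u_N(x)=\sum_{n=-N}^N\widehat u_N(n)e(nx)$$ such that $$\log|1-e(x)|\le u_N(x)$$ at each point $x$ in $\mathbb{R}/\mathbb{Z}$, $$\frac{\log2}{N+1}=\int_{\mathbb{R}/\mathbb{Z}}u_N(x)\,dx,$$ and $$-\frac{1}{2|n|}\le\widehat u_N(n)\le0$$ for each integer $n$ with $1\le|n|\le N$. If $\widetilde u(x)$ is a real trigonometric polynomial of degree at most $N$ such that $\log|1-e(x)|\le\widetilde u(x)$ at each point $x$ in $\mathbb{R}/\mathbb{Z}$, then $$\frac{\log 2}{N+1}\le\int_{\mathbb{R}/\mathbb{Z}}\widetilde u(x)\,dx.$$ Moreover, there is equality in this last inequality if and only if $\widetilde u(x)=u_N(x)$.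
   Context: Here $e(x)=e^{2\pi i x}$, $\log 0=-\infty$, and integrals over $\mathbb{R}/\mathbb{Z}$ are with respect to Haar measure normalized so that $\mathbb{R}/\mathbb{Z}$ has measure $1$. A (real) trigonometric polynomial of degree at most $N$ is a (real valued) function of the form $\sum_{n=-N}^N c_n e(nx)$ with complex coefficients $c_n$. *)

theory Defs
  imports "HOL-Analysis.Analysis"
begin

text \<open>
  Functions on $\mathbb{R}/\mathbb{Z}$ are represented by 1-periodic functions on the reals;
  every function satisfying \<open>trig_poly\<close> below is 1-periodic.
\<close>

definition e :: "real \<Rightarrow> complex"
  where "e x = exp (2 * of_real pi * \<i> * of_real x)"

text \<open>
  Normalized Haar measure on $\mathbb{R}/\mathbb{Z}$ is Lebesgue measure on the fundamental
  domain $[0,1)$.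
\<close>
definition circle_integral :: "(real \<Rightarrow> 'a::{banach, second_countable_topology}) \<Rightarrow> 'a"
  where "circle_integral f = (LINT x:{0..<1}|lborel. f x)"

definition ext_log :: "real \<Rightarrow> ereal"
  where "ext_log r = (if r = 0 then -\<infinity> else ereal (ln r))"

definition trig_poly :: "nat \<Rightarrow> (real \<Rightarrow> complex) \<Rightarrow> bool"
  where "trig_poly N f \<longleftrightarrow>
    (\<exists>c :: int \<Rightarrow> complex. \<forall>x. f x = (\<Sum>n = - int N..int N. c n * e (of_int n * x)))"

definition real_trig_poly :: "nat \<Rightarrow> (real \<Rightarrow> real) \<Rightarrow> bool"
  where "real_trig_poly N u \<longleftrightarrow> trig_poly N (\<lambda>x. complex_of_real (u x))"

definition fourier_coeff :: "(real \<Rightarrow> real) \<Rightarrow> int \<Rightarrow> complex"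
  where "fourier_coeff u n = circle_integral (\<lambda>x. complex_of_real (u x) * e (- of_int n * x))"

end

theory Submission
  imports Defs
begin

text \<open>
  With \<open>z = e x\<close>, \<open>log |1 - z|\<close> is minus one half of the integral over \<open>0 < r < 1\<close> of
  \<open>(P r x - 1) / r\<close>, where \<open>P r x = (1 - r\<^sup>2) / |1 - r z|\<^sup>2\<close> is the Poisson kernel.
  Put \<open>M = N + 1\<close>. Since
  \<open>|1 + z ^ M|\<^sup>2\<close> vanishes doubly exactly at the points \<open>x\<^sub>j = (j + 1/2) / M\<close>, subtracting
  \<open>P r x * r ^ M * |1 + z ^ M|\<^sup>2 / (1 + r ^ M)\<^sup>2\<close> from \<open>P r x\<close> leaves a trigonometric polynomial
  of degree at most \<open>N\<close> below \<open>P r x\<close> with explicit coefficients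
  \<open>(r ^ |n| - r ^ (2 M - |n|)) / (1 + r ^ M)\<^sup>2\<close>. Integrating over \<open>r\<close> gives the extremal majorant
  together with its Fourier coefficients, and it touches the logarithm at the \<open>x\<^sub>j\<close>.

  The mean of a trigonometric polynomial of degree at most \<open>N\<close> is its average over the \<open>x\<^sub>j\<close>, so
  no majorant has a smaller integral. In the case of equality the majorant also touches the
  logarithm at every \<open>x\<^sub>j\<close>, so its difference \<open>w\<close> from the extremal one has \<open>w = w' = 0\<close> there.
  The discrete Fourier transforms of \<open>w\<close> and \<open>w'\<close> over the \<open>x\<^sub>j\<close> yield
  \<open>d m = d (m - M)\<close> and \<open>m * d m = (m - M) * d (m - M)\<close> for the coefficients of \<open>w\<close>,
  which forces \<open>d = 0\<close>.
\<close>

section \<open>The exponential and the modulus of 1 - e(x)\<close>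

lemma e_eq_cis: "e x = cis (2 * pi * x)"
  by (simp add: e_def cis_conv_exp mult_ac)

lemma e_add: "e (x + y) = e x * e y"
  by (simp add: e_eq_cis cis_mult algebra_simps)

lemma cmod_one_minus_e: "cmod (1 - e x) = sqrt (2 - 2 * cos (2 * pi * x))"
proof -
  have "(cmod (1 - e x))\<^sup>2 = (1 - cos (2 * pi * x))\<^sup>2 + (sin (2 * pi * x))\<^sup>2"
    by (simp add: cmod_power2 e_eq_cis)
  also have "\<dots> = 2 - 2 * cos (2 * pi * x)"
    by (simp add: sin_squared_eq power2_eq_square algebra_simps)
  finally show ?thesis
    by (metis norm_ge_zero real_sqrt_unique)
qed

lemma ln_cmod_one_minus_e: "ln (cmod (1 - e x)) = ln (2 - 2 * cos (2 * pi * x)) / 2"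
  if "cos (2 * pi * x) < 1"
  using that by (simp add: cmod_one_minus_e ln_sqrt)

section \<open>Radial integrals and interpolation of the Poisson kernel\<close>

lemma poisson_denominator_pos:
  fixes r c :: real
  assumes "0 \<le> r" "c < 1"
  shows "1 - 2 * r * c + r\<^sup>2 > 0"
proof (cases "r = 0")
  case False
  then have "2 * r * (1 - c) > 0"
    using assms by simp
  moreover have "1 - 2 * r * c + r\<^sup>2 = (1 - r)\<^sup>2 + 2 * r * (1 - c)"
    by (simp add: power2_eq_square algebra_simps)
  ultimately show ?thesis
    by (simp add: add_nonneg_pos)
qed simp

text \<open>For c = cos t the denominator is |1 - r e^(it)|^2, so the integrand is the r-derivative
  of log |1 - r e^(it)|, which vanishes at r = 0. It equals -(P - 1) / (2 r) with P the Poisson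
  kernel.\<close>

lemma has_integral_log_derivative:
  fixes c :: real
  assumes "c < 1"
  shows "((\<lambda>r. (r - c) / (1 - 2 * r * c + r\<^sup>2)) has_integral ln (2 - 2 * c) / 2) {0..1}"
proof -
  have "((\<lambda>r. (r - c) / (1 - 2 * r * c + r\<^sup>2)) has_integral
      ln (1 - 2 * 1 * c + 1\<^sup>2) / 2 - ln (1 - 2 * 0 * c + 0\<^sup>2) / 2) {0..1}"
  proof (rule fundamental_theorem_of_calculus)
    fix r :: real assume "r \<in> {0..1}"
    then have "1 - 2 * r * c + r\<^sup>2 > 0"
      using assms poisson_denominator_pos by simp
    then show "((\<lambda>r. ln (1 - 2 * r * c + r\<^sup>2) / 2) has_vector_derivative
        (r - c) / (1 - 2 * r * c + r\<^sup>2)) (at r within {0..1})"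
      unfolding has_real_derivative_iff_has_vector_derivative[symmetric]
      by (auto intro!: derivative_eq_intros simp: field_simps)
  qed simp
  then show ?thesis by simp
qed

text \<open>This produces the mean of the majorant: subtracting 1 from the constant coefficient (1 -
  r^M) / (1 + r^M) of the interpolating polynomial and multiplying by -1 / (2 r) gives the
  integrand.\<close>

lemma has_integral_constant_term:
  "((\<lambda>r::real. r ^ N / (1 + r ^ Suc N)) has_integral ln 2 / (real N + 1)) {0..1}"
proof -
  have "((\<lambda>r::real. r ^ N / (1 + r ^ Suc N)) has_integral
      ln (1 + 1 ^ Suc N) / (real N + 1) - ln (1 + 0 ^ Suc N) / (real N + 1)) {0..1}"
  proof (rule fundamental_theorem_of_calculus)
    fix r :: real assume "r \<in> {0..1}"
    then have "1 + r ^ Suc N > 0"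
      by (simp add: add_pos_nonneg)
    then show "((\<lambda>r. ln (1 + r ^ Suc N) / (real N + 1)) has_vector_derivative
        r ^ N / (1 + r ^ Suc N)) (at r within {0..1})"
      unfolding has_real_derivative_iff_has_vector_derivative[symmetric]
      by (auto intro!: derivative_eq_intros simp: divide_simps simp del: power_Suc)
  qed simp
  then show ?thesis by simp
qed

text \<open>Index \<open>k\<close> belongs to frequency n = k + 1. Dividing r^n - r^(2M - n) by r
  leaves the exponents \<open>k\<close> and \<open>2 * N - k\<close>.\<close>

definition extremal_coeff :: "nat \<Rightarrow> nat \<Rightarrow> real"
  where "extremal_coeff N k =
    integral {0..1} (\<lambda>r. (r ^ k - r ^ (2 * N - k)) / (1 + r ^ Suc N)\<^sup>2)"

lemma extremal_coeff_has_integral: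
  "((\<lambda>r::real. (r ^ k - r ^ (2 * N - k)) / (1 + r ^ Suc N)\<^sup>2) has_integral extremal_coeff N k) {0..1}"
proof -
  have "1 + r ^ Suc N \<noteq> 0" if "r \<in> {0..1}" for r :: real
    using zero_le_power[of r "Suc N"] that by fastforce
  then have "continuous_on {0..1} (\<lambda>r::real. (r ^ k - r ^ (2 * N - k)) / (1 + r ^ Suc N)\<^sup>2)"
    by (intro continuous_intros) auto
  then show ?thesis
    unfolding extremal_coeff_def by (intro integrable_integral integrable_continuous_real)
qed

text \<open>On [0, 1] the integrand lies between 0 and r^k, because k <= 2N - k and the denominator
  is at least 1.\<close>

lemma extremal_coeff_bounds:
  assumes "k < N"
  shows "0 \<le> extremal_coeff N k" "extremal_coeff N k \<le> 1 / real (Suc k)"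
proof -
  have *: "0 \<le> (r ^ k - r ^ (2 * N - k)) / (1 + r ^ Suc N)\<^sup>2
      \<and> (r ^ k - r ^ (2 * N - k)) / (1 + r ^ Suc N)\<^sup>2 \<le> r ^ k" if "r \<in> {0..1}" for r :: real
  proof -
    have "r ^ (2 * N - k) \<le> r ^ k"
      using that assms by (intro power_decreasing) auto
    moreover have "1 \<le> (1 + r ^ Suc N)\<^sup>2"
      using that by (intro one_le_power) simp
    then have "(r ^ k - r ^ (2 * N - k)) / (1 + r ^ Suc N)\<^sup>2 \<le> (r ^ k - r ^ (2 * N - k)) / 1"
      using \<open>r ^ (2 * N - k) \<le> r ^ k\<close> by (intro divide_left_mono) auto
    moreover have "0 \<le> r ^ (2 * N - k)"
      using that by simp
    ultimately show ?thesis by simp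
  qed
  show "0 \<le> extremal_coeff N k"
    using * by (intro has_integral_nonneg[OF extremal_coeff_has_integral]) auto
  have "((\<lambda>r::real. r ^ k) has_integral 1 ^ Suc k / real (Suc k) - 0 ^ Suc k / real (Suc k)) {0..1}"
    by (rule fundamental_theorem_of_calculus)
      (auto simp: has_real_derivative_iff_has_vector_derivative[symmetric] simp del: power_Suc
        intro!: derivative_eq_intros)
  then have "((\<lambda>r::real. r ^ k) has_integral 1 / real (Suc k)) {0..1}"
    by simp
  then show "extremal_coeff N k \<le> 1 / real (Suc k)"
    using * by (intro has_integral_le[OF extremal_coeff_has_integral]) auto
qed

text \<open>
  The weights \<open>r ^ n - r ^ (2 * N + 2 - n)\<close> and the cosines \<open>cos (n * t)\<close> satisfy
  three-term recurrences whose difference is the factor \<open>1 - 2 * r * cos t + r\<^sup>2\<close>,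
  so the product telescopes as a discrete Wronskian.
\<close>
lemma poisson_denominator_times_partial_sum:
  fixes r t :: real
  assumes "K \<le> N"
  shows "(1 - 2 * r * cos t + r\<^sup>2) * (\<Sum>k<K. (r ^ k - r ^ (2 * N - k)) * cos (real (Suc k) * t)) =
    (r ^ Suc K - r ^ (2 * N + 1 - K)) * cos (real K * t)
    - (r ^ K - r ^ (2 * N + 2 - K)) * cos (real (Suc K) * t)
    - (r - r ^ (2 * N + 1)) + (1 - r ^ (2 * N + 2)) * cos t"
  using assms
proof (induction K)
  case (Suc K)
  \<comment> \<open>Every power becomes a multiple of \<open>p\<close> or \<open>q\<close>, which
    removes the truncated subtractions and leaves a polynomial identity.\<close>
  define p where "p = r ^ K"
  define q where "q = r ^ (2 * N - Suc K)"
  have exps: "2 * N - K = Suc (2 * N - Suc K)" "2 * N + 1 - K = Suc (Suc (2 * N - Suc K))"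
    "2 * N + 2 - K = Suc (Suc (Suc (2 * N - Suc K)))"
    "2 * N + 1 - Suc K = Suc (2 * N - Suc K)"
    "2 * N + 2 - Suc K = Suc (Suc (2 * N - Suc K))"
    using Suc.prems by auto
  have pows: "r ^ (2 * N - K) = r * q" "r ^ (2 * N + 1 - K) = r * (r * q)"
    "r ^ (2 * N + 2 - K) = r * (r * (r * q))"
    "r ^ (2 * N + 1 - Suc K) = r * q" "r ^ (2 * N + 2 - Suc K) = r * (r * q)"
    "r ^ K = p" "r ^ Suc K = r * p" "r ^ Suc (Suc K) = r * (r * p)"
    unfolding exps p_def q_def by simp_all
  define C where "C = cos (real (Suc K) * t)"
  define S where "S = sin (real (Suc K) * t)"
  have "real K * t = real (Suc K) * t - t" "real (Suc (Suc K)) * t = real (Suc K) * t + t"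
    by (simp_all add: algebra_simps)
  then have coss: "cos (real K * t) = C * cos t + S * sin t"
    "cos (real (Suc (Suc K)) * t) = C * cos t - S * sin t" "cos (real (Suc K) * t) = C"
    unfolding C_def S_def by (simp_all only: cos_diff cos_add)
  have IH: "(1 - 2 * r * cos t + r\<^sup>2) * (\<Sum>k<K. (r ^ k - r ^ (2 * N - k)) * cos (real (Suc k) * t)) =
    (r * p - r * (r * q)) * (C * cos t + S * sin t)
    - (p - r * (r * (r * q))) * C
    - (r - r ^ (2 * N + 1)) + (1 - r ^ (2 * N + 2)) * cos t"
    using Suc by (simp only: pows coss Suc_leD)
  show ?case
    unfolding sum.lessThan_Suc distrib_left IH pows coss
    by (simp add: algebra_simps power2_eq_square)
qed (simp add: algebra_simps)

text \<open>
  Integrated over \<open>r\<close>, this is the identity between the extremal polynomial, the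
  logarithm, and their nonnegative difference. The right-hand side is the error term
  in interpolating the Poisson kernel at the zeros of \<open>1 + cos ((N + 1) * t)\<close>.
\<close>
lemma interpolation_identity:
  fixes r t :: real
  assumes r: "r \<in> {0..1}" and t: "cos t < 1"
  shows "r ^ N / (1 + r ^ Suc N)
      - (\<Sum>k<N. (r ^ k - r ^ (2 * N - k)) / (1 + r ^ Suc N)\<^sup>2 * cos (real (Suc k) * t))
      - (r - cos t) / (1 - 2 * r * cos t + r\<^sup>2) =
    (1 + cos (real (Suc N) * t)) * (1 - r\<^sup>2) * r ^ N
      / ((1 - 2 * r * cos t + r\<^sup>2) * (1 + r ^ Suc N)\<^sup>2)"
proof -
  define D where "D = 1 - 2 * r * cos t + r\<^sup>2"
  define S where "S = (\<Sum>k<N. (r ^ k - r ^ (2 * N - k)) * cos (real (Suc k) * t))"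
  define p where "p = r ^ N"
  define Q where "Q = 1 + r * p"
  define C where "C = cos (real (Suc N) * t)"
  have D: "D > 0"
    using poisson_denominator_pos[of r "cos t"] r t by (simp add: D_def)
  have Q: "Q > 0"
    using r by (simp add: Q_def p_def add_pos_nonneg)
  have exps: "2 * N + 1 - N = Suc N" "2 * N + 2 - N = Suc (Suc N)" "2 * N + 1 = N + N + 1"
    "2 * N + 2 = N + N + 2"
    by auto
  have "D * S = (r ^ Suc N - r ^ (2 * N + 1 - N)) * cos (real N * t)
    - (r ^ N - r ^ (2 * N + 2 - N)) * cos (real (Suc N) * t)
    - (r - r ^ (2 * N + 1)) + (1 - r ^ (2 * N + 2)) * cos t"
    unfolding D_def S_def by (rule poisson_denominator_times_partial_sum) simp
  \<comment> \<open>At K = N the weight of cos (N t) is r^(N+1) - r^(N+1) = 0, so of the two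
    boundary cosines only \<open>C\<close> survives.\<close>
  also have "\<dots> = - p * (1 - r\<^sup>2) * C - (r - p * p * r) + (1 - p * p * r\<^sup>2) * cos t"
    unfolding exps C_def[symmetric]
    by (simp add: p_def power_add power2_eq_square algebra_simps)
  finally have DS: "D * S = \<dots>" .
  have "p * Q * D - D * S - (r - cos t) * Q\<^sup>2 = (1 + C) * (1 - r\<^sup>2) * p"
    unfolding DS unfolding D_def Q_def by (simp add: algebra_simps power2_eq_square)
  moreover have "p / Q - S / Q\<^sup>2 - (r - cos t) / D =
      (p * Q * D - D * S - (r - cos t) * Q\<^sup>2) / (D * Q\<^sup>2)"
    using D Q by (simp add: field_simps power2_eq_square)
  moreover have "(\<Sum>k<N. (r ^ k - r ^ (2 * N - k)) / (1 + r ^ Suc N)\<^sup>2 * cos (real (Suc k) * t)) =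
      S / Q\<^sup>2"
    by (simp add: S_def Q_def p_def sum_divide_distrib)
  ultimately show ?thesis
    by (simp add: D_def Q_def p_def C_def)
qed

section \<open>The extremal polynomial compared with the logarithm\<close>

definition extremal :: "nat \<Rightarrow> real \<Rightarrow> real"
  where "extremal N x = ln 2 / (real N + 1)
    - (\<Sum>k<N. extremal_coeff N k * cos (real (Suc k) * (2 * pi * x)))"

lemma extremal_minus_log_has_integral:
  assumes "cos (2 * pi * x) < 1"
  shows "((\<lambda>r. (1 + cos (real (Suc N) * (2 * pi * x))) * (1 - r\<^sup>2) * r ^ N
      / ((1 - 2 * r * cos (2 * pi * x) + r\<^sup>2) * (1 + r ^ Suc N)\<^sup>2))
    has_integral extremal N x - ln (cmod (1 - e x))) {0..1}"
proof -
  have "((\<lambda>r. r ^ N / (1 + r ^ Suc N)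
      - (\<Sum>k<N. (r ^ k - r ^ (2 * N - k)) / (1 + r ^ Suc N)\<^sup>2 * cos (real (Suc k) * (2 * pi * x)))
      - (r - cos (2 * pi * x)) / (1 - 2 * r * cos (2 * pi * x) + r\<^sup>2))
    has_integral extremal N x - ln (cmod (1 - e x))) {0..1}"
    unfolding extremal_def ln_cmod_one_minus_e[OF assms]
    by (intro has_integral_diff has_integral_sum has_integral_mult_left
        has_integral_constant_term extremal_coeff_has_integral
        has_integral_log_derivative assms) auto
  then show ?thesis
    by (rule has_integral_eq[rotated]) (rule interpolation_identity[OF _ assms])
qed

lemma log_le_extremal:
  assumes "cos (2 * pi * x) < 1"
  shows "ln (cmod (1 - e x)) \<le> extremal N x"
proof -
  have "0 \<le> (1 + cos (real (Suc N) * (2 * pi * x))) * (1 - r\<^sup>2) * r ^ N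
      / ((1 - 2 * r * cos (2 * pi * x) + r\<^sup>2) * (1 + r ^ Suc N)\<^sup>2)" if "r \<in> {0..1}" for r
  proof -
    have "0 \<le> 1 + cos (real (Suc N) * (2 * pi * x))"
      using cos_ge_minus_one[of "real (Suc N) * (2 * pi * x)"] by linarith
    moreover have "0 \<le> 1 - r\<^sup>2"
      using that by (simp add: power_le_one)
    moreover have "0 \<le> 1 - 2 * r * cos (2 * pi * x) + r\<^sup>2"
      using poisson_denominator_pos[OF _ assms] that by (simp add: less_imp_le)
    ultimately show ?thesis
      using that by simp
  qed
  then have "0 \<le> extremal N x - ln (cmod (1 - e x))"
    by (rule has_integral_nonneg[OF extremal_minus_log_has_integral[OF assms]])
  then show ?thesis by simp
qed

text \<open>The second hypothesis kills the factor 1 + cos, so the difference is the integral of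
  0.\<close>

lemma extremal_eq_log:
  assumes "cos (2 * pi * x) < 1" "cos (real (Suc N) * (2 * pi * x)) = -1"
  shows "extremal N x = ln (cmod (1 - e x))"
proof -
  have "((\<lambda>r::real. 0) has_integral extremal N x - ln (cmod (1 - e x))) {0..1}"
    using extremal_minus_log_has_integral[OF assms(1), of N] assms(2) by simp
  then show ?thesis
    using has_integral_unique by fastforce
qed

section \<open>Circle integrals and coefficients of trigonometric sums\<close>

lemma circle_integral_eqI:
  fixes f :: "real \<Rightarrow> 'a::euclidean_space"
  assumes "continuous_on UNIV f" "(f has_integral I) {0..1}"
  shows "circle_integral f = I"
proof -
  have "set_integrable lborel {0..1} f"
    using assms(1) unfolding set_integrable_def
    by (intro borel_integrable_compact) (auto intro: continuous_on_subset)
  then have "set_integrable lborel {0..<1} f"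
    by (rule set_integrable_subset) auto
  then have "circle_integral f = integral {0..<1} f"
    unfolding circle_integral_def by (rule set_borel_integral_eq_integral)
  also have "\<dots> = integral {0..1} f"
    by (rule integral_spike_set) (auto intro: negligible_subset[of "{1}"])
  finally show ?thesis
    using assms(2) by (simp add: integral_unique)
qed

lemma has_vector_derivative_e:
  "((\<lambda>x. e (a * x)) has_vector_derivative 2 * of_real pi * \<i> * of_real a * e (a * x)) (at x within S)"
proof -
  have "((\<lambda>z. exp (2 * of_real pi * \<i> * (of_real a * z))) has_field_derivative
      2 * of_real pi * \<i> * of_real a * e (a * x)) (at (of_real x))"
    unfolding e_def by (auto intro!: derivative_eq_intros)
  then show ?thesis
    unfolding e_def of_real_mult by (rule has_vector_derivative_real_field)
qed

lemma continuous_on_e [continuous_intros]: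
  "continuous_on S g \<Longrightarrow> continuous_on S (\<lambda>x. e (g x))"
  unfolding e_def by (intro continuous_intros)

lemma e_of_int [simp]: "e (of_int n) = 1"
  by (auto simp: e_def exp_eq_1)

lemma e_eq_1_iff: "e x = 1 \<longleftrightarrow> x \<in> \<int>"
  by (auto simp: e_def exp_eq_1 elim!: Ints_cases)

lemma e_of_int_has_integral:
  "((\<lambda>x. e (of_int n * x)) has_integral (if n = 0 then 1 else 0)) {0..1}"
proof (cases "n = 0")
  case True
  then show ?thesis
    using has_integral_const_real[of "1::complex" 0 1] by (simp add: e_def)
next
  case False
  define a where "a = 2 * of_real pi * \<i> * of_int n"
  have "a \<noteq> 0"
    using False by (simp add: a_def)
  have "((\<lambda>x. e (of_int n * x)) has_integral e (of_int n * 1) / a - e (of_int n * 0) / a) {0..1}"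
  proof (rule fundamental_theorem_of_calculus)
    fix x :: real
    have "((\<lambda>x. e (of_int n * x) / a) has_vector_derivative
        2 * of_real pi * \<i> * of_real (of_int n) * e (of_int n * x) / a) (at x within {0..1})"
      by (intro has_vector_derivative_divide has_vector_derivative_e)
    then show "((\<lambda>x. e (of_int n * x) / a) has_vector_derivative e (of_int n * x))
        (at x within {0..1})"
      using \<open>a \<noteq> 0\<close> by (simp add: a_def)
  qed simp
  moreover have "e (of_int n * 1) = 1" "e (of_int n * 0) = 1"
    using e_of_int[of n] e_of_int[of 0] by simp_all
  ultimately show ?thesis
    using False by simp
qed

text \<open>With the coefficients as an argument, differentiation becomes an operation on
  \<open>c\<close>; values of \<open>c\<close> outside -N..N do not matter.\<close>

definition trig_sum :: "nat \<Rightarrow> (int \<Rightarrow> complex) \<Rightarrow> real \<Rightarrow> complex"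
  where "trig_sum N c x = (\<Sum>n = - int N..int N. c n * e (of_int n * x))"

lemma trig_poly_iff: "trig_poly N f \<longleftrightarrow> (\<exists>c. f = trig_sum N c)"
  by (auto simp: trig_poly_def trig_sum_def fun_eq_iff)

lemma trig_sum_diff: "trig_sum N (\<lambda>n. c n - d n) x = trig_sum N c x - trig_sum N d x"
  by (simp add: trig_sum_def algebra_simps sum_subtractf)

lemma has_vector_derivative_trig_sum:
  "(trig_sum N c has_vector_derivative
    2 * of_real pi * \<i> * trig_sum N (\<lambda>n. of_int n * c n) x) (at x)"
proof -
  have "((\<lambda>x. \<Sum>n = - int N..int N. c n * e (of_int n * x)) has_vector_derivative
      (\<Sum>n = - int N..int N. c n * (2 * of_real pi * \<i> * of_real (of_int n) * e (of_int n * x)))) (at x)"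
    by (intro has_vector_derivative_sum has_vector_derivative_mult_right has_vector_derivative_e)
  then show ?thesis
    unfolding trig_sum_def[abs_def] by (simp add: sum_distrib_left mult_ac)
qed

lemma continuous_on_trig_sum: "continuous_on S (trig_sum N c)"
  unfolding trig_sum_def[abs_def] by (intro continuous_intros)

text \<open>Common starting point for extracting coefficients by integration and by summation over
  the nodes.\<close>

lemma trig_sum_mult_e:
  "trig_sum N c x * e (- of_int m * x) = (\<Sum>n = - int N..int N. c n * e (of_int (n - m) * x))"
proof -
  have "e (of_int (n - m) * x) = e (of_int n * x) * e (- of_int m * x)" for n
    by (simp add: algebra_simps flip: e_add)
  then show ?thesis
    by (simp add: trig_sum_def sum_distrib_right mult.assoc)
qed

lemma trig_sum_mult_e_has_integral:
  assumes "m \<in> {- int N..int N}"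
  shows "((\<lambda>x. trig_sum N c x * e (- of_int m * x)) has_integral c m) {0..1}"
proof -
  have "((\<lambda>x. \<Sum>n = - int N..int N. c n * e (of_int (n - m) * x)) has_integral
      (\<Sum>n = - int N..int N. c n * (if n - m = 0 then 1 else 0))) {0..1}"
    by (intro has_integral_sum has_integral_mult_right e_of_int_has_integral) auto
  moreover have "(\<Sum>n = - int N..int N. c n * (if n - m = 0 then 1 else 0)) = c m"
    using assms by (simp add: if_distrib sum.delta cong: if_cong)
  ultimately show ?thesis
    by (simp only: trig_sum_mult_e)
qed

lemma fourier_coeff_trig_sum:
  assumes "\<And>x. of_real (u x) = trig_sum N c x" "m \<in> {- int N..int N}"
  shows "fourier_coeff u m = c m"
  unfolding fourier_coeff_def assms(1) using assms(2)
  by (intro circle_integral_eqI trig_sum_mult_e_has_integral continuous_intros continuous_on_trig_sum)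

lemma circle_integral_trig_sum:
  assumes "\<And>x. of_real (u x) = trig_sum N c x"
  shows "circle_integral u = Re (c 0)"
proof (rule circle_integral_eqI)
  have u: "u = (\<lambda>x. Re (trig_sum N c x))"
    by (simp flip: assms)
  show "continuous_on UNIV u"
    unfolding u by (intro continuous_intros continuous_on_trig_sum)
  have "(trig_sum N c has_integral c 0) {0..1}"
    using trig_sum_mult_e_has_integral[of 0 N c] by (simp add: e_def)
  then show "(u has_integral Re (c 0)) {0..1}"
    unfolding u using has_integral_linear[OF _ bounded_linear_Re] by (force simp: o_def)
qed

text \<open>Pairing n with -n turns exponentials into cosines; this lets the Fourier coefficients of
  \<open>extremal\<close> be read off.\<close>

lemma trig_sum_even:
  "trig_sum N (\<lambda>n. of_real (g (nat \<bar>n\<bar>))) x =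
    of_real (g 0 + (\<Sum>k<N. 2 * g (Suc k) * cos (real (Suc k) * (2 * pi * x))))"
proof (induction N)
  case 0
  then show ?case
    by (simp add: trig_sum_def e_def)
next
  case (Suc N)
  have "{- int (Suc N)..int (Suc N)} =
      insert (int (Suc N)) (insert (- int (Suc N)) {- int N..int N})"
    by auto
  then have "trig_sum (Suc N) (\<lambda>n. of_real (g (nat \<bar>n\<bar>))) x =
      of_real (g (Suc N)) * (e (real (Suc N) * x) + e (- real (Suc N) * x))
      + trig_sum N (\<lambda>n. of_real (g (nat \<bar>n\<bar>))) x"
    by (simp add: trig_sum_def algebra_simps nat_add_distrib)
  also have "e (real (Suc N) * x) + e (- real (Suc N) * x) =
      of_real (2 * cos (real (Suc N) * (2 * pi * x)))"
    by (simp add: e_eq_cis complex_eq_iff mult_ac del: of_nat_Suc)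
  finally show ?case
    using Suc.IH by (simp del: of_nat_Suc)
qed

text \<open>The half comes from splitting a cosine into two exponentials, the shift from
  \<open>extremal_coeff\<close> counting from frequency 1.\<close>

definition extremal_fourier :: "nat \<Rightarrow> nat \<Rightarrow> real"
  where "extremal_fourier N n = (if n = 0 then ln 2 / (real N + 1) else - extremal_coeff N (n - 1) / 2)"

lemma extremal_eq_trig_sum:
  "of_real (extremal N x) = trig_sum N (\<lambda>n. of_real (extremal_fourier N (nat \<bar>n\<bar>))) x"
  unfolding trig_sum_even by (simp add: extremal_def extremal_fourier_def sum_negf)

lemma circle_integral_extremal: "circle_integral (extremal N) = ln 2 / (real N + 1)"
  by (simp add: circle_integral_trig_sum[OF extremal_eq_trig_sum] extremal_fourier_def)

section \<open>The nodes, the discrete Fourier transform and quadrature\<close>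

definition node :: "nat \<Rightarrow> nat \<Rightarrow> real"
  where "node N j = (real j + 1 / 2) / (real N + 1)"

lemma Suc_mult_node: "real (Suc N) * (2 * pi * node N j) = pi + 2 * pi * real j"
  by (simp add: node_def field_simps)

lemma cos_Suc_mult_node: "cos (real (Suc N) * (2 * pi * node N j)) = -1"
  unfolding Suc_mult_node using cos_int_2pin[of "int j"] by (simp add: cos_add)

lemma node_bounds: "j < Suc N \<Longrightarrow> 0 < node N j \<and> node N j < 1"
  by (auto simp: node_def field_simps)

lemma cos_node_less_1:
  assumes "j < Suc N"
  shows "cos (2 * pi * node N j) < 1"
proof -
  have "cos (2 * pi * node N j) \<noteq> 1"
  proof
    assume "cos (2 * pi * node N j) = 1"
    then obtain k :: int where "2 * pi * node N j = of_int k * 2 * pi"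
      by (auto simp: cos_one_2pi_int)
    then have "node N j = of_int k"
      by simp
    then have "0 < k" "k < 1"
      using node_bounds[OF assms] by simp_all
    then show False
      by simp
  qed
  then show ?thesis
    using cos_le_one[of "2 * pi * node N j"] by linarith
qed

text \<open>The terms form a geometric progression whose ratio e(n/M) is an M-th root of unity other
  than 1.\<close>

lemma sum_e_nodes_eq_0:
  assumes "\<not> int (Suc N) dvd n"
  shows "(\<Sum>j<Suc N. e (of_int n * node N j)) = 0"
proof -
  define z where "z = e (of_int n / real (Suc N))"
  have "z \<noteq> 1"
  proof
    assume "z = 1"
    then obtain k where "of_int n / real (Suc N) = of_int k"
      unfolding z_def e_eq_1_iff by (auto elim: Ints_cases)
    then have "of_int n = (of_int (int (Suc N) * k) :: real)"
      by (simp add: field_simps)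
    then show False
      using assms by (metis dvd_triv_left of_int_eq_iff)
  qed
  have zpow: "z ^ j = e (real j * of_int n / real (Suc N))" for j
    by (induction j) (simp_all add: z_def e_add[symmetric] add_divide_distrib algebra_simps e_eq_1_iff)
  have "e (of_int n * node N j) = e (of_int n / (2 * real (Suc N))) * z ^ j" for j
  proof -
    have "of_int n * node N j = of_int n / (2 * real (Suc N)) + real j * of_int n / real (Suc N)"
      by (simp add: node_def divide_simps) (simp add: algebra_simps)
    then show ?thesis
      by (simp only: zpow e_add)
  qed
  then have "(\<Sum>j<Suc N. e (of_int n * node N j)) =
      e (of_int n / (2 * real (Suc N))) * (\<Sum>j<Suc N. z ^ j)"
    by (simp only: sum_distrib_left)
  also have "(\<Sum>j<Suc N. z ^ j) = (z ^ Suc N - 1) / (z - 1)"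
    using \<open>z \<noteq> 1\<close> by (rule geometric_sum)
  also have "z ^ Suc N = 1"
    unfolding zpow by (simp del: of_nat_Suc)
  finally show ?thesis by simp
qed

text \<open>For |n| <= N and 0 <= m <= N the difference n - m lies in [-2N, N], where 0 and -M are
  the only multiples of M. At -M each term is -1 because of the half shift in the nodes.\<close>

lemma sum_e_nodes:
  assumes "\<bar>n\<bar> < 2 * int (Suc N)" "n \<noteq> int (Suc N)"
  shows "(\<Sum>j<Suc N. e (of_int n * node N j)) =
    (if n = 0 then of_nat (Suc N) else if n = - int (Suc N) then - of_nat (Suc N) else 0)"
proof -
  consider "n = 0" | "n = - int (Suc N)" | "\<not> int (Suc N) dvd n"
  proof (cases "int (Suc N) dvd n")
    case True
    then obtain k where k: "n = int (Suc N) * k" ..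
    then have "int (Suc N) * \<bar>k\<bar> < int (Suc N) * 2"
      using assms(1) by (simp add: abs_mult)
    then have "\<bar>k\<bar> < 2"
      by (subst (asm) mult_less_cancel_left_pos) auto
    then have "k = -1 \<or> k = 0 \<or> k = 1"
      by auto
    with k assms(2) that show ?thesis by auto
  qed
  then show ?thesis
  proof cases
    case 2
    have "e (of_int n * node N j) = -1" for j
    proof -
      have "2 * pi * (of_int n * node N j) = - (real (Suc N) * (2 * pi * node N j))"
        by (simp add: 2 algebra_simps)
      then have "e (of_int n * node N j) = cis (- (pi + 2 * pi * real j))"
        unfolding e_eq_cis by (simp only: Suc_mult_node)
      also have "\<dots> = -1"
        using cos_int_2pin[of "int j"] sin_int_2pin[of "int j"]
        by (simp add: complex_eq_iff cos_add sin_add cos_diff sin_diff)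
      finally show ?thesis .
    qed
    with 2 show ?thesis by simp
  next
    case 3
    then have "n \<noteq> 0" "n \<noteq> - int (Suc N)"
      by (metis dvd_0_right, metis dvd_minus_iff dvd_refl)
    then show ?thesis
      by (simp only: sum_e_nodes_eq_0[OF 3] if_False)
  qed (simp add: e_def)
qed

text \<open>On the nodes, frequency m - M is an alias of m with opposite sign. For m = 0 the alias
  -M is out of range, so \<open>c 0\<close> stands alone.\<close>

lemma discrete_fourier_nodes:
  assumes "0 \<le> m" "m \<le> int N"
  shows "(\<Sum>j<Suc N. trig_sum N c (node N j) * e (- of_int m * node N j)) =
    of_nat (Suc N) * (c m - (if m = 0 then 0 else c (m - int (Suc N))))"
proof -
  have "(\<Sum>j<Suc N. trig_sum N c (node N j) * e (- of_int m * node N j)) =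
      (\<Sum>j<Suc N. \<Sum>n = - int N..int N. c n * e (of_int (n - m) * node N j))"
    by (simp only: trig_sum_mult_e)
  also have "\<dots> = (\<Sum>n = - int N..int N. c n * (\<Sum>j<Suc N. e (of_int (n - m) * node N j)))"
    by (subst sum.swap) (simp only: sum_distrib_left)
  also have "\<dots> = (\<Sum>n = - int N..int N. c n * (if n - m = 0 then of_nat (Suc N)
      else if n - m = - int (Suc N) then - of_nat (Suc N) else 0))"
    using assms by (intro sum.cong refl arg_cong2[of _ _ _ _ "(*)"] sum_e_nodes) auto
  also have "\<dots> = (\<Sum>n = - int N..int N. (if n = m then c n * of_nat (Suc N) else 0)
      - (if n = m - int (Suc N) then c n * of_nat (Suc N) else 0))"
    by (intro sum.cong) (auto simp: algebra_simps)
  also have "\<dots> = c m * of_nat (Suc N) - (if m = 0 then 0 else c (m - int (Suc N)) * of_nat (Suc N))"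
    unfolding sum_subtractf using assms by (subst (1 2) sum.delta) auto
  also have "\<dots> = of_nat (Suc N) * (c m - (if m = 0 then 0 else c (m - int (Suc N))))"
    by (simp add: algebra_simps del: of_nat_Suc)
  finally show ?thesis .
qed

lemma trig_sum_quadrature: "(\<Sum>j<Suc N. trig_sum N c (node N j)) = of_nat (Suc N) * c 0"
  using discrete_fourier_nodes[of 0 N c] by (simp add: e_def)

lemma circle_integral_quadrature:
  assumes "\<And>x. of_real (u x) = trig_sum N c x"
  shows "(\<Sum>j<Suc N. u (node N j)) = real (Suc N) * circle_integral u"
proof -
  have "(\<Sum>j<Suc N. u (node N j)) = Re (\<Sum>j<Suc N. trig_sum N c (node N j))"
    by (simp flip: assms)
  also have "\<dots> = real (Suc N) * circle_integral u"
    by (simp add: trig_sum_quadrature circle_integral_trig_sum[OF assms] del: sum.lessThan_Suc)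
  finally show ?thesis .
qed

section \<open>Double zeros, contact with the logarithm, and uniqueness\<close>

lemma trig_sum_double_zeros:
  assumes f: "\<And>j. j < Suc N \<Longrightarrow> trig_sum N c (node N j) = 0"
    and f': "\<And>j. j < Suc N \<Longrightarrow> trig_sum N (\<lambda>n. of_int n * c n) (node N j) = 0"
  shows "trig_sum N c x = 0"
proof -
  have 1: "c m - (if m = 0 then 0 else c (m - int (Suc N))) = 0" if "0 \<le> m" "m \<le> int N" for m
    using discrete_fourier_nodes[OF that, of c] f by (simp del: of_nat_Suc sum.lessThan_Suc)
  have 2: "of_int m * c m - (if m = 0 then 0 else of_int (m - int (Suc N)) * c (m - int (Suc N))) = 0"
    if "0 \<le> m" "m \<le> int N" for m
    using discrete_fourier_nodes[OF that, of "\<lambda>n. of_int n * c n"] f'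
    by (simp del: of_nat_Suc sum.lessThan_Suc of_int_diff)
  \<comment> \<open>Facts \<open>1\<close> and \<open>2\<close> are two linear equations in
    \<open>c m\<close> and \<open>c (m - M)\<close> with determinant M, hence only the zero
    solution.\<close>
  have *: "c m = 0 \<and> c (m - int (Suc N)) = 0" if "1 \<le> m" "m \<le> int N" for m
  proof -
    have eq: "c (m - int (Suc N)) = c m"
      using 1[of m] that by simp
    have "of_int m * c m - of_int (m - int (Suc N)) * c m = 0"
      using 2[of m] that eq by simp
    then have "of_nat (Suc N) * c m = 0"
      by (simp add: algebra_simps)
    then show ?thesis
      using eq by (simp del: of_nat_Suc)
  qed
  have "c n = 0" if "n \<in> {- int N..int N}" for n
  proof -
    consider "n = 0" | "1 \<le> n" | "n \<le> -1"
      by linarith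
    then show ?thesis
    proof cases
      case 1
      then show ?thesis
        using \<open>\<And>m. 0 \<le> m \<Longrightarrow> m \<le> int N \<Longrightarrow> c m - (if m = 0 then 0 else c (m - int (Suc N))) = 0\<close>[of 0]
        by simp
    next
      case 2
      then show ?thesis using *[of n] that by simp
    next
      case 3
      \<comment> \<open>A negative n is the alias of the positive frequency n + M.\<close>
      then show ?thesis using *[of "n + int (Suc N)"] that by simp
    qed
  qed
  then show ?thesis
    by (simp add: trig_sum_def)
qed

text \<open>A majorant minus the logarithm has a local minimum at a contact point. The resulting
  slope depends on the logarithm alone, so all majorants touching at \<open>x\<close> share
  it.\<close>

lemma log_majorant_contact_derivative:
  assumes major: "\<And>y. cos (2 * pi * y) < 1 \<Longrightarrow> ln (cmod (1 - e y)) \<le> v y"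
    and eq: "v x = ln (cmod (1 - e x))" and x: "cos (2 * pi * x) < 1"
    and v: "(v has_real_derivative a) (at x)"
  shows "a = 2 * pi * sin (2 * pi * x) / (2 - 2 * cos (2 * pi * x))"
proof -
  define G where "G y = v y - ln (2 - 2 * cos (2 * pi * y)) / 2" for y
  have "(G has_real_derivative a - 2 * pi * sin (2 * pi * x) / (2 - 2 * cos (2 * pi * x))) (at x)"
    unfolding G_def using x by (auto intro!: derivative_eq_intros v simp: field_simps)
  \<comment> \<open>A whole neighbourhood of \<open>x\<close> avoids the singularities of the
    logarithm, so the majorant bound applies throughout it.\<close>
  moreover have "open {y. cos (2 * pi * y) < 1}"
    by (intro open_Collect_less continuous_intros)
  then obtain d where d: "d > 0" "\<And>y. \<bar>x - y\<bar> < d \<Longrightarrow> cos (2 * pi * y) < 1"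
    using x unfolding open_dist by (auto simp: dist_real_def abs_minus_commute)
  moreover have "G x \<le> G y" if "\<bar>x - y\<bar> < d" for y
    using major[OF d(2)[OF that]] eq ln_cmod_one_minus_e[OF x] ln_cmod_one_minus_e[OF d(2)[OF that]]
    by (simp add: G_def)
  ultimately have "a - 2 * pi * sin (2 * pi * x) / (2 - 2 * cos (2 * pi * x)) = 0"
    by (metis DERIV_local_min)
  then show ?thesis by simp
qed

text \<open>Where e(x) = 1 the left side is minus infinity and nothing is demanded; elsewhere the
  logarithm is an ordinary real number.\<close>

lemma ext_log_le_iff:
  "ext_log (cmod (1 - e x)) \<le> ereal (v x) \<longleftrightarrow>
    (cos (2 * pi * x) < 1 \<longrightarrow> ln (cmod (1 - e x)) \<le> v x)"
proof -
  have "cmod (1 - e x) = 0 \<longleftrightarrow> cos (2 * pi * x) = 1"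
    unfolding cmod_one_minus_e by simp
  moreover have "cos (2 * pi * x) < 1 \<longleftrightarrow> cos (2 * pi * x) \<noteq> 1"
    using cos_le_one[of "2 * pi * x"] by linarith
  ultimately show ?thesis
    by (simp add: ext_log_def del: right_minus_eq norm_eq_zero)
qed

lemma log_majorant_eq_extremal:
  assumes v: "\<And>x. of_real (v x) = trig_sum N c x"
    and major: "\<And>x. cos (2 * pi * x) < 1 \<Longrightarrow> ln (cmod (1 - e x)) \<le> v x"
    and nodes: "\<And>j. j < Suc N \<Longrightarrow> v (node N j) = extremal N (node N j)"
  shows "v = extremal N"
proof
  fix x
  define a where "a = (\<lambda>n. complex_of_real (extremal_fourier N (nat \<bar>n\<bar>)))"
  have u: "of_real (extremal N x) = trig_sum N a x" for x
    unfolding a_def by (rule extremal_eq_trig_sum)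
  \<comment> \<open>Stated for any majorant \<open>w\<close> that meets \<open>extremal\<close> at a
    node, so that it applies both to \<open>v\<close> and to \<open>extremal\<close> itself.\<close>
  have deriv: "2 * of_real pi * \<i> * trig_sum N (\<lambda>n. of_int n * b n) (node N j) =
      of_real (2 * pi * sin (2 * pi * node N j) / (2 - 2 * cos (2 * pi * node N j)))"
    if j: "j < Suc N" and w: "\<And>x. of_real (w x) = trig_sum N b x"
      and w_major: "\<And>x. cos (2 * pi * x) < 1 \<Longrightarrow> ln (cmod (1 - e x)) \<le> w x"
      and w_node: "w (node N j) = extremal N (node N j)" for j w b
  proof -
    let ?D = "2 * of_real pi * \<i> * trig_sum N (\<lambda>n. of_int n * b n) (node N j)"
    have D: "((\<lambda>x. complex_of_real (w x)) has_vector_derivative ?D) (at (node N j))"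
      unfolding w by (rule has_vector_derivative_trig_sum)
    then have "((\<lambda>x. Re (of_real (w x))) has_vector_derivative Re ?D) (at (node N j))"
      by (rule bounded_linear.has_vector_derivative[OF bounded_linear_Re])
    then have w': "(w has_real_derivative Re ?D) (at (node N j))"
      by (simp add: has_real_derivative_iff_has_vector_derivative)
    \<comment> \<open>As \<open>w\<close> is real valued, uniqueness of derivatives forces
      \<open>?D\<close> to be real, so the slope fixes \<open>?D\<close> entirely.\<close>
    then have "((\<lambda>x. complex_of_real (w x)) has_vector_derivative of_real (Re ?D)) (at (node N j))"
      by (rule has_vector_derivative_of_real[unfolded o_def])
    then have "?D = of_real (Re ?D)"
      by (rule vector_derivative_unique_at[OF D])
    also have "Re ?D = 2 * pi * sin (2 * pi * node N j) / (2 - 2 * cos (2 * pi * node N j))"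
    proof (rule log_majorant_contact_derivative[OF w_major _ cos_node_less_1[OF j] w'])
      show "w (node N j) = ln (cmod (1 - e (node N j)))"
        unfolding w_node by (rule extremal_eq_log[OF cos_node_less_1[OF j] cos_Suc_mult_node])
    qed
    finally show ?thesis .
  qed
  have "trig_sum N (\<lambda>n. c n - a n) x = 0"
  proof (rule trig_sum_double_zeros)
    fix j assume j: "j < Suc N"
    show "trig_sum N (\<lambda>n. c n - a n) (node N j) = 0"
      unfolding trig_sum_diff using nodes[OF j] by (simp flip: u v)
    have "2 * of_real pi * \<i> * trig_sum N (\<lambda>n. of_int n * c n) (node N j) =
        2 * of_real pi * \<i> * trig_sum N (\<lambda>n. of_int n * a n) (node N j)"
      using deriv[OF j v major nodes[OF j]] deriv[OF j u log_le_extremal refl] by simp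
    then show "trig_sum N (\<lambda>n. of_int n * (c n - a n)) (node N j) = 0"
      by (simp add: right_diff_distrib trig_sum_diff)
  qed
  then have "complex_of_real (v x) = of_real (extremal N x)"
    by (simp add: trig_sum_diff u v)
  then show "v x = extremal N x"
    by simp
qed

section \<open>Existence, optimality and uniqueness of the majorant\<close>

theorem theorem1p5:
  fixes N :: nat
  shows "\<exists>u :: real \<Rightarrow> real.
    real_trig_poly N u \<and>
    (\<forall>x. complex_of_real (u x) =
      (\<Sum>n = - int N..int N. fourier_coeff u n * e (of_int n * x))) \<and>
    (\<forall>x. ext_log (cmod (1 - e x)) \<le> ereal (u x)) \<and>
    ln 2 / (real N + 1) = circle_integral u \<and>
    (\<forall>n :: int. 1 \<le> \<bar>n\<bar> \<and> \<bar>n\<bar> \<le> int N \<longrightarrow>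
      fourier_coeff u n \<in> \<real> \<and>
      - (1 / (2 * real_of_int \<bar>n\<bar>)) \<le> Re (fourier_coeff u n) \<and>
      Re (fourier_coeff u n) \<le> 0) \<and>
    (\<forall>v :: real \<Rightarrow> real.
      real_trig_poly N v \<and> (\<forall>x. ext_log (cmod (1 - e x)) \<le> ereal (v x)) \<longrightarrow>
      ln 2 / (real N + 1) \<le> circle_integral v \<and>
      (ln 2 / (real N + 1) = circle_integral v \<longleftrightarrow> v = u))"
proof (intro exI[of _ "extremal N"] conjI allI impI)
  define a where "a = (\<lambda>n. complex_of_real (extremal_fourier N (nat \<bar>n\<bar>)))"
  have u: "of_real (extremal N x) = trig_sum N a x" for x
    unfolding a_def by (rule extremal_eq_trig_sum)
  have coeff: "fourier_coeff (extremal N) n = a n" if "n \<in> {- int N..int N}" for n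
    using fourier_coeff_trig_sum[OF u that] .
  show "real_trig_poly N (extremal N)"
    using u by (auto simp: real_trig_poly_def trig_poly_iff)
  show "complex_of_real (extremal N x) =
      (\<Sum>n = - int N..int N. fourier_coeff (extremal N) n * e (of_int n * x))" for x
    unfolding u trig_sum_def by (intro sum.cong refl) (simp only: coeff)
  show "ext_log (cmod (1 - e x)) \<le> ereal (extremal N x)" for x
    unfolding ext_log_le_iff using log_le_extremal by blast
  show "ln 2 / (real N + 1) = circle_integral (extremal N)"
    by (rule circle_integral_extremal[symmetric])
  fix n :: int assume n: "1 \<le> \<bar>n\<bar> \<and> \<bar>n\<bar> \<le> int N"
  then have an: "fourier_coeff (extremal N) n = of_real (- extremal_coeff N (nat \<bar>n\<bar> - 1) / 2)"
    by (subst coeff) (auto simp: a_def extremal_fourier_def)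
  show "fourier_coeff (extremal N) n \<in> \<real>"
    unfolding an by (rule Reals_of_real)
  have "nat \<bar>n\<bar> - 1 < N" "real (Suc (nat \<bar>n\<bar> - 1)) = real_of_int \<bar>n\<bar>"
    using n by auto
  with extremal_coeff_bounds[of "nat \<bar>n\<bar> - 1" N]
  have "0 \<le> extremal_coeff N (nat \<bar>n\<bar> - 1)" "extremal_coeff N (nat \<bar>n\<bar> - 1) \<le> 1 / real_of_int \<bar>n\<bar>"
    by simp_all
  then show "- (1 / (2 * real_of_int \<bar>n\<bar>)) \<le> Re (fourier_coeff (extremal N) n)"
    "Re (fourier_coeff (extremal N) n) \<le> 0"
    unfolding an by simp_all
next
  fix v :: "real \<Rightarrow> real"
  assume "real_trig_poly N v \<and> (\<forall>x. ext_log (cmod (1 - e x)) \<le> ereal (v x))"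
  then obtain c where v: "\<And>x. of_real (v x) = trig_sum N c x"
    and major: "\<And>x. cos (2 * pi * x) < 1 \<Longrightarrow> ln (cmod (1 - e x)) \<le> v x"
    unfolding real_trig_poly_def trig_poly_iff ext_log_le_iff by (metis (no_types))
  note u = extremal_eq_trig_sum and int = circle_integral_extremal[symmetric]
  have le: "extremal N (node N j) \<le> v (node N j)" if "j < Suc N" for j
    using major[OF cos_node_less_1[OF that]]
      extremal_eq_log[OF cos_node_less_1[OF that] cos_Suc_mult_node] by simp
  \<comment> \<open>Quadrature turns this comparison at the nodes into one between the
    integrals.\<close>
  have "(\<Sum>j<Suc N. extremal N (node N j)) \<le> (\<Sum>j<Suc N. v (node N j))"
    using le by (intro sum_mono) auto
  then show "ln 2 / (real N + 1) \<le> circle_integral v"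
    unfolding int circle_integral_quadrature[OF u] circle_integral_quadrature[OF v]
    by (subst (asm) mult_le_cancel_left_pos) auto
  show "ln 2 / (real N + 1) = circle_integral v \<longleftrightarrow> v = extremal N"
  proof
    assume "ln 2 / (real N + 1) = circle_integral v"
    \<comment> \<open>Equal integrals make these nonnegative differences sum to 0, so each of them
      vanishes.\<close>
    then have "(\<Sum>j<Suc N. v (node N j) - extremal N (node N j)) = 0"
      unfolding sum_subtractf circle_integral_quadrature[OF u] circle_integral_quadrature[OF v] int
      by simp
    then have "v (node N j) - extremal N (node N j) = 0" if "j < Suc N" for j
      using le that by (subst (asm) sum_nonneg_eq_0_iff) auto
    then show "v = extremal N"
      by (intro log_majorant_eq_extremal[OF v major]) auto
  qed (simp add: int)
qed

end
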